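(* The following statements hold: (i) $\mathcal{U}'_2\subsetneq\overline{\mathcal{U}'_2}\subsetneq\mathcal{V}'_2$. (ii) $(\mu,\alpha)\in\overline{\mathcal{U}'_2}$ if and only if $(\mu,\alpha)\in\mathcal{V}'_2$ and there are no $m,n\in\mathbb{N}$ such that both $\sigma^m(\mu)=\alpha$ and $\sigma^n(\alpha)=\mu$ hold. (iii) $(\mu,\alpha)\in\mathcal{V}'_2\setminus\overline{\mathcal{U}'_2}$ if and only if $(\mu,\alpha)\in\mathcal{V}'_2$ and there exist $m,n\in\mathbb{N}$ such that both $\sigma^m(\mu)=\alpha$ and $\sigma^n(\alpha)=\mu$ hold. (iv) $\mathcal{V}'_2$ is compact. (v) $\overline{\mathcal{U}'_2}$ is a Cantor set. (vi) $\overline{\mathcal{U}'_2}\setminus\mathcal{U}'_2$ is dense in $\overline{\mathcal{U}'_2}$; $\mathcal{V}'_2\setminus\overline{\mathcal{U}'_2}$ is countable and dense in $\mathcal{V}'_2$. (vii) $\overline{\mathcal{U}'_2}\setminus\mathcal{U}'_2$ is uncountable.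
   Context: $\mathbb{N}=\{1,2,\dots\}$, $\mathbb{N}_0=\mathbb{N}\cup\{0\}$. $\Sigma_2=\{0,1\}^{\mathbb{N}}$; $\Sigma_2^0$ and $\Sigma_2^1$ are the sets of sequences $(d_i)\in\Sigma_2$ with $d_1=0$ and $d_1=1$, respectively. $\sigma((d_i))=(d_{i+1})$ is the left shift. $\prec,\preccurlyeq$ refer to the lexicographic order. $\Sigma_2$ carries the metric $d((c_i),(e_i))=2^{-j}$ with $j=\min\{i:c_i\ne e_i\}$ if $(c_i)\neq(e_i)$, and $0$ otherwise; $\Sigma_2\times\Sigma_2$ carries the max of the two coordinate metrics, and all topological notions refer to this metric. Define $$\mathcal{U}'_2=\{(\mu,\alpha)\in\Sigma_2^0\times\Sigma_2^1:\ \mu\prec\sigma^m(\mu)\prec\alpha,\ \mu\prec\sigma^n(\alpha)\prec\alpha\text{ for all }m,n\in\mathbb{N}\},$$ $$\mathcal{V}'_2=\{(\mu,\alpha)\in\Sigma_2^0\times\Sigma_2^1:\ \mu\preccurlyeq\sigma^m(\mu)\preccurlyeq\alpha,\ \mu\preccurlyeq\sigma^n(\alpha)\preccurlyeq\alpha\text{ for all }m,n\in\mathbb{N}_0\},$$ and let $\overline{\mathcal{U}'_2}$ be the topological closure of $\mathcal{U}'_2$. A Cantor set means a non-empty compact set having neither isolated points nor interior points (interior taken in the ambient space $\Sigma_2\times\Sigma_2$). *)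

theory Defs
  imports "HOL-Analysis.Analysis"
begin

text \<open>
  A 0-1 sequence \<open>(d\<^sub>1, d\<^sub>2, \<dots>)\<close> is a function \<open>c\<close> on the natural numbers with \<open>c i\<close> the
  digit \<open>d\<^bsub>i+1\<^esub>\<close> (so positions start at 0), where \<open>False\<close> is the digit 0 and \<open>True\<close> the digit 1.
\<close>

type_synonym bseq = "nat \<Rightarrow> bool"

definition Sigma0 :: "bseq set"
  where "Sigma0 = {c. \<not> c 0}"

definition Sigma1 :: "bseq set"
  where "Sigma1 = {c. c 0}"

definition shift :: "bseq \<Rightarrow> bseq"
  where "shift c = (\<lambda>i. c (Suc i))"

text \<open>
  The lexicographic order. It is kept apart from the order symbols of the function type,
  which denote the pointwise order.
\<close>

definition lex_less :: "bseq \<Rightarrow> bseq \<Rightarrow> bool"  (infix "\<prec>" 50)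
  where "c \<prec> e \<longleftrightarrow> (\<exists>k. (\<forall>i<k. c i = e i) \<and> c k < e k)"

definition lex_le :: "bseq \<Rightarrow> bseq \<Rightarrow> bool"  (infix "\<preceq>" 50)
  where "c \<preceq> e \<longleftrightarrow> c \<prec> e \<or> c = e"

text \<open>The successor in the exponent accounts for positions being counted from 0 here.\<close>

definition seq_dist :: "bseq \<Rightarrow> bseq \<Rightarrow> real"
  where "seq_dist c e = (if c = e then 0 else (1/2) ^ Suc (LEAST i. c i \<noteq> e i))"

definition pair_dist :: "bseq \<times> bseq \<Rightarrow> bseq \<times> bseq \<Rightarrow> real"
  where "pair_dist p q = max (seq_dist (fst p) (fst q)) (seq_dist (snd p) (snd q))"

lemma seq_dist_nonneg: "0 \<le> seq_dist c e"
  by (simp add: seq_dist_def)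

lemma seq_dist_commute: "seq_dist c e = seq_dist e c"
  unfolding seq_dist_def by (simp add: eq_commute)

lemma seq_dist_eq_0_iff: "seq_dist c e = 0 \<longleftrightarrow> c = e"
  by (simp add: seq_dist_def)

lemma seq_dist_ultrametric: "seq_dist c f \<le> max (seq_dist c e) (seq_dist e f)"
proof (cases "c = e \<or> e = f \<or> c = f")
  case True
  then show ?thesis
    by (auto simp: seq_dist_def le_max_iff_disj)
next
  case False
  define k where "k = (LEAST i. c i \<noteq> f i)"
  define l where "l = (LEAST i. c i \<noteq> e i)"
  define m where "m = (LEAST i. e i \<noteq> f i)"
  have "c k \<noteq> f k"
    using False LeastI_ex[of "\<lambda>i. c i \<noteq> f i"] unfolding k_def by auto
  then have "c k \<noteq> e k \<or> e k \<noteq> f k"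
    by auto
  then have "l \<le> k \<or> m \<le> k"
    unfolding l_def m_def
    using Least_le[of "\<lambda>i. c i \<noteq> e i" k] Least_le[of "\<lambda>i. e i \<noteq> f i" k] by argo
  then have "(1/2::real) ^ Suc k \<le> (1/2) ^ Suc l \<or> (1/2::real) ^ Suc k \<le> (1/2) ^ Suc m"
    by (auto intro!: power_decreasing simp del: power_Suc)
  moreover have "seq_dist c f = (1/2) ^ Suc k" "seq_dist c e = (1/2) ^ Suc l"
    "seq_dist e f = (1/2) ^ Suc m"
    using False by (simp_all only: seq_dist_def k_def l_def m_def if_False de_Morgan_disj)
  ultimately show ?thesis
    by (simp only: le_max_iff_disj)
qed

interpretation Seq2: Metric_space UNIV pair_dist
proof
  fix p q r :: "bseq \<times> bseq"
  show "0 \<le> pair_dist p q"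
    by (simp add: pair_dist_def seq_dist_nonneg le_max_iff_disj)
  show "pair_dist p q = pair_dist q p"
    by (simp add: pair_dist_def seq_dist_commute)
  show "pair_dist p q = 0 \<longleftrightarrow> p = q"
    using seq_dist_nonneg[of "fst p" "fst q"] seq_dist_nonneg[of "snd p" "snd q"]
    unfolding pair_dist_def prod_eq_iff seq_dist_eq_0_iff[symmetric] by linarith
  show "pair_dist p r \<le> pair_dist p q + pair_dist q r"
    using seq_dist_ultrametric[of "fst p" "fst r" "fst q"]
      seq_dist_ultrametric[of "snd p" "snd r" "snd q"]
      seq_dist_nonneg[of "fst p" "fst q"] seq_dist_nonneg[of "fst q" "fst r"]
      seq_dist_nonneg[of "snd p" "snd q"] seq_dist_nonneg[of "snd q" "snd r"]
    unfolding pair_dist_def by linarith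
qed

definition U2' :: "(bseq \<times> bseq) set"
  where "U2' = {(\<mu>, \<alpha>). \<mu> \<in> Sigma0 \<and> \<alpha> \<in> Sigma1 \<and>
    (\<forall>m\<ge>1. \<mu> \<prec> (shift ^^ m) \<mu> \<and> (shift ^^ m) \<mu> \<prec> \<alpha>) \<and>
    (\<forall>n\<ge>1. \<mu> \<prec> (shift ^^ n) \<alpha> \<and> (shift ^^ n) \<alpha> \<prec> \<alpha>)}"

definition V2' :: "(bseq \<times> bseq) set"
  where "V2' = {(\<mu>, \<alpha>). \<mu> \<in> Sigma0 \<and> \<alpha> \<in> Sigma1 \<and>
    (\<forall>m. \<mu> \<preceq> (shift ^^ m) \<mu> \<and> (shift ^^ m) \<mu> \<preceq> \<alpha>) \<and>
    (\<forall>n. \<mu> \<preceq> (shift ^^ n) \<alpha> \<and> (shift ^^ n) \<alpha> \<preceq> \<alpha>)}"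

definition cl_U2' :: "(bseq \<times> bseq) set"
  where "cl_U2' = Seq2.mtopology closure_of U2'"

definition cantor_set_in :: "'a topology \<Rightarrow> 'a set \<Rightarrow> bool"
  where "cantor_set_in X S \<longleftrightarrow> S \<noteq> {} \<and> compactin X S \<and>
    \<not> (\<exists>x\<in>S. \<exists>T. openin X T \<and> T \<inter> S = {x}) \<and>
    X interior_of S = {}"

definition dense_subset_of :: "'a topology \<Rightarrow> 'a set \<Rightarrow> 'a set \<Rightarrow> bool"
  where "dense_subset_of X A S \<longleftrightarrow> A \<subseteq> S \<and> S \<subseteq> X closure_of A"

end

theory Submission
  imports Defs "HOL-Library.Omega_Words_Fun"
begin

text \<open>
  Call a pair \<open>(\<mu>, \<alpha>)\<close> linked if each of its two sequences is a shift of the other. The closure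
  of \<open>U2'\<close> is the set of unlinked pairs of \<open>V2'\<close>, and every part of the theorem follows from
  this and from one construction that approximates unlinked pairs.

  Linked pairs are isolated in \<open>V2'\<close> (\<open>linked_isolated\<close>). If \<open>\<mu>\<close> and \<open>\<alpha>\<close> run through the same
  periodic orbit, then whenever a nearby admissible pair deviates for the first time from this
  orbit, some shift by a bounded amount before the deviation starts like \<open>\<mu>\<close>, and another one
  like \<open>\<alpha>\<close>. A deviation downwards produces a shift below \<open>\<mu>\<close>, one upwards a shift above \<open>\<alpha>\<close>,
  so there is no deviation. As \<open>V2'\<close> is closed and \<open>U2'\<close> has no linked pairs, the closure of
  \<open>U2'\<close> has none either.

  Conversely, let \<open>(\<mu>, \<alpha>)\<close> be an unlinked pair. Exchanging the digits 0 and 1 and the two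
  components preserves everything, so one may assume that no shift of \<open>\<alpha>\<close> equals \<open>\<mu>\<close>. Cut off
  \<open>\<alpha>\<close> at a late position and take the longest suffix of the resulting word, say from index \<open>j\<close>
  on, that is a prefix of \<open>\<mu>\<close>. This match ends at some position \<open>k\<close>, where \<open>\<alpha>\<close> has the digit 1
  and \<open>\<mu>\<close> the digit 0. So there is a choice at \<open>k\<close>: to go on as \<open>\<alpha>\<close> does, or to have
  followed \<open>\<mu>\<close> from \<open>j\<close> on. Likewise let \<open>i\<close> be the index in \<open>\<mu>\<close> from where on the first
  \<open>k + 1\<close> digits of \<open>\<mu>\<close> follow \<open>\<alpha>\<close> for the longest time. Let \<open>u\<close> be the prefix of \<open>\<mu>\<close> of
  length \<open>i\<close>, and \<open>v\<close>, \<open>w\<close> the prefixes of \<open>\<alpha>\<close> of lengths \<open>j\<close> and \<open>k + 1\<close>. The substitution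
  \<open>code\<close> with \<open>0 \<mapsto> v u\<close> and \<open>1 \<mapsto> w u\<close> is strictly increasing, and the map
  \<open>(m, a) \<mapsto> (u code(m), code(a))\<close> carries \<open>V2'\<close> into the neighbourhood of \<open>(\<mu>, \<alpha>)\<close> in \<open>V2'\<close>
  given by the first \<open>k\<close> digits. The reason is that all comparisons with shifts that start inside
  one of the words \<open>u\<close>, \<open>v\<close>, \<open>w\<close> are strict and decided within the first \<open>k + 1\<close> digits
  (\<open>lower_interior\<close>, \<open>code_interior\<close>), so that only shifts at word boundaries matter, and these
  compare as the shifts of \<open>m\<close> and \<open>a\<close> do. Applying the map to three fixed pairs gives points
  of \<open>U2'\<close>, unlinked points of \<open>V2'\<close> outside \<open>U2'\<close>, and linked points near every unlinked
  pair (\<open>approximations\<close>). Hence the unlinked pairs form the closure of \<open>U2'\<close>, without isolated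
  points, and both density claims hold. An explicit family of pairs \<open>(\<mu>, 111\<dots>)\<close> shows that
  uncountably many unlinked pairs lie outside \<open>U2'\<close>.
\<close>

no_notation lesspoll (infixl \<open>\<prec>\<close> 50)

section \<open>Lexicographic comparison of finite prefixes\<close>

lemma shift_power [simp]: "(shift ^^ m) x = suffix m x"
  by (induction m) (auto simp: shift_def fun_eq_iff)

definition eq_upto :: "nat \<Rightarrow> bseq \<Rightarrow> bseq \<Rightarrow> bool"
  where "eq_upto n x y \<longleftrightarrow> (\<forall>t<n. x t = y t)"

definition lex_less_upto :: "nat \<Rightarrow> bseq \<Rightarrow> bseq \<Rightarrow> bool"
  where "lex_less_upto n x y \<longleftrightarrow> (\<exists>r<n. eq_upto r x y \<and> \<not> x r \<and> y r)"

lemma eq_upto_refl [simp]: "eq_upto n x x"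
  by (simp add: eq_upto_def)

lemma eq_upto_commute: "eq_upto n x y \<longleftrightarrow> eq_upto n y x"
  by (auto simp: eq_upto_def)

lemma eq_upto_mono: "eq_upto n x y \<Longrightarrow> m \<le> n \<Longrightarrow> eq_upto m x y"
  by (auto simp: eq_upto_def)

lemma lex_less_iff: "x \<prec> y \<longleftrightarrow> (\<exists>r. eq_upto r x y \<and> \<not> x r \<and> y r)"
  by (simp add: lex_less_def eq_upto_def)

lemma first_difference:
  assumes "x \<noteq> (y :: bseq)"
  obtains r where "eq_upto r x y" "x r \<noteq> y r"
proof -
  have "\<exists>r. x r \<noteq> y r"
    using assms by (simp add: fun_eq_iff)
  then have "x (LEAST r. x r \<noteq> y r) \<noteq> y (LEAST r. x r \<noteq> y r)"
    by (rule LeastI_ex)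
  moreover have "eq_upto (LEAST r. x r \<noteq> y r) x y"
    unfolding eq_upto_def using not_less_Least by blast
  ultimately show thesis
    by (rule that[rotated])
qed

lemma lex_less_irrefl [simp]: "\<not> x \<prec> x"
  by (auto simp: lex_less_iff)

lemma lex_less_asym: "x \<prec> y \<Longrightarrow> \<not> y \<prec> x"
  unfolding lex_less_iff eq_upto_def by (metis linorder_neqE_nat)

lemma not_lex_le: "\<not> x \<preceq> y \<longleftrightarrow> y \<prec> x"
proof
  assume *: "\<not> x \<preceq> y"
  then obtain r where "eq_upto r x y" "x r \<noteq> y r"
    using first_difference[of x y] by (auto simp: lex_le_def)
  then show "y \<prec> x"
    using * unfolding lex_le_def lex_less_iff by (metis eq_upto_commute)
qed (use lex_less_asym in \<open>auto simp: lex_le_def\<close>)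

lemma lex_less_imp_le: "x \<prec> y \<Longrightarrow> x \<preceq> y"
  by (simp add: lex_le_def)

lemma lex_le_refl [simp]: "x \<preceq> x"
  by (simp add: lex_le_def)

lemma lex_less_first_digit: "\<not> x 0 \<Longrightarrow> y 0 \<Longrightarrow> x \<prec> y"
  unfolding lex_less_iff by (rule exI[of _ 0]) (simp add: eq_upto_def)

lemma lex_less_upto_imp_lex_less:
  assumes "lex_less_upto n x y"
    and "\<And>t. t < n \<Longrightarrow> x' t = x t" "\<And>t. t < n \<Longrightarrow> y' t = y t"
  shows "x' \<prec> y'"
  using assms unfolding lex_less_upto_def lex_less_iff eq_upto_def
  by (metis less_trans)

lemma lex_le_imp_lex_less_upto:
  assumes "x \<preceq> y" "\<not> eq_upto n x y"
  shows "lex_less_upto n x y"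
proof -
  obtain r where r: "eq_upto r x y" "\<not> x r" "y r"
    using assms unfolding lex_le_def lex_less_iff by auto
  then have "r < n"
    using assms(2) eq_upto_mono by (meson not_le_imp_less)
  then show ?thesis
    using r unfolding lex_less_upto_def by auto
qed

lemma lex_le_next_digit:
  assumes "x \<preceq> y" "eq_upto n x y" "x n"
  shows "y n"
proof (rule ccontr)
  assume "\<not> y n"
  then have "y \<prec> x"
    unfolding lex_less_iff using assms(2,3) eq_upto_commute by blast
  then show False
    using assms(1) not_lex_le by blast
qed

lemma lex_less_prependI:
  assumes "eq_upto n x y" "suffix n x \<prec> suffix n y"
  shows "x \<prec> y"
proof -
  obtain r where r: "eq_upto r (suffix n x) (suffix n y)" "\<not> x (n + r)" "y (n + r)"
    using assms(2) by (auto simp: lex_less_iff)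
  have "x t = y t" if "t < n + r" for t
  proof (cases "t < n")
    case False
    then have "t - n < r" "n + (t - n) = t"
      using that by auto
    then show ?thesis
      using r(1) unfolding eq_upto_def suffix_nth by metis
  qed (use assms(1) in \<open>auto simp: eq_upto_def\<close>)
  then show ?thesis
    using r unfolding lex_less_iff eq_upto_def by blast
qed

section \<open>Admissible pairs, linked pairs and reflection\<close>

lemma V2'_iff: "(\<mu>, \<alpha>) \<in> V2' \<longleftrightarrow> \<not> \<mu> 0 \<and> \<alpha> 0 \<and>
    (\<forall>n. \<mu> \<preceq> suffix n \<mu> \<and> suffix n \<mu> \<preceq> \<alpha> \<and> \<mu> \<preceq> suffix n \<alpha> \<and> suffix n \<alpha> \<preceq> \<alpha>)"
  by (auto simp: V2'_def Sigma0_def Sigma1_def)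

lemma U2'_iff: "(\<mu>, \<alpha>) \<in> U2' \<longleftrightarrow> \<not> \<mu> 0 \<and> \<alpha> 0 \<and>
    (\<forall>n\<ge>1. \<mu> \<prec> suffix n \<mu> \<and> suffix n \<mu> \<prec> \<alpha> \<and> \<mu> \<prec> suffix n \<alpha> \<and> suffix n \<alpha> \<prec> \<alpha>)"
  by (auto simp: U2'_def Sigma0_def Sigma1_def)

text \<open>
  Both sequences of a linked pair are periodic and run through the same orbit.
\<close>

definition linked :: "(bseq \<times> bseq) set"
  where "linked = {(\<mu>, \<alpha>). \<exists>m\<ge>1. \<exists>n\<ge>1. suffix m \<mu> = \<alpha> \<and> suffix n \<alpha> = \<mu>}"

lemma U2'_subset: "U2' \<subseteq> V2' - linked"
proof
  fix p
  assume "p \<in> U2'"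
  then obtain \<mu> \<alpha> where p: "p = (\<mu>, \<alpha>)" and U: "(\<mu>, \<alpha>) \<in> U2'"
    by (cases p) auto
  have "\<mu> \<preceq> suffix n \<mu> \<and> suffix n \<mu> \<preceq> \<alpha> \<and> \<mu> \<preceq> suffix n \<alpha> \<and> suffix n \<alpha> \<preceq> \<alpha>" for n
    using U lex_less_first_digit[of \<mu> \<alpha>] unfolding U2'_iff
    by (cases n) (auto intro: lex_less_imp_le)
  moreover have "(\<mu>, \<alpha>) \<notin> linked"
    using U unfolding U2'_iff linked_def by auto
  ultimately show "p \<in> V2' - linked"
    using U by (simp add: p V2'_iff U2'_iff)
qed

lemma periodic_not_U2':
  assumes "suffix n \<alpha> = \<alpha>" "n \<ge> 1"
  shows "(\<mu>, \<alpha>) \<notin> U2'"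
  using assms unfolding U2'_iff by (metis lex_less_irrefl)

lemma not_linked_if_aperiodic:
  assumes "\<And>n. n \<ge> 1 \<Longrightarrow> \<mu> \<prec> suffix n \<mu>"
  shows "(\<mu>, \<alpha>) \<notin> linked"
proof
  assume "(\<mu>, \<alpha>) \<in> linked"
  then obtain m n where "m \<ge> 1" "suffix (m + n) \<mu> = \<mu>"
    by (auto simp: linked_def)
  then show False
    using assms[of "m + n"] by simp
qed

text \<open>
  Exchanging the digits reverses the lexicographic order, so the two components have to be
  exchanged as well for their roles as lower and upper bound to be kept.
\<close>

definition reflect :: "bseq \<times> bseq \<Rightarrow> bseq \<times> bseq"
  where "reflect p = (Not \<circ> snd p, Not \<circ> fst p)"

lemma reflect_reflect [simp]: "reflect (reflect p) = p"
  by (auto simp: reflect_def fun_eq_iff prod_eq_iff)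

lemma suffix_Not [simp]: "suffix n (Not \<circ> x) = Not \<circ> suffix n x"
  by (simp add: fun_eq_iff)

lemma lex_less_Not [simp]: "Not \<circ> x \<prec> Not \<circ> y \<longleftrightarrow> y \<prec> x"
  by (auto simp: lex_less_iff eq_upto_def)

lemma Not_comp_eq [simp]: "Not \<circ> x = Not \<circ> y \<longleftrightarrow> x = y"
  by (auto simp: fun_eq_iff)

lemma lex_le_Not [simp]: "Not \<circ> x \<preceq> Not \<circ> y \<longleftrightarrow> y \<preceq> x"
  by (auto simp: lex_le_def)

lemma reflect_V2' [simp]: "reflect p \<in> V2' \<longleftrightarrow> p \<in> V2'"
  by (cases p) (auto simp: reflect_def V2'_iff)

lemma reflect_U2' [simp]: "reflect p \<in> U2' \<longleftrightarrow> p \<in> U2'"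
  by (cases p) (auto simp: reflect_def U2'_iff)

lemma reflect_linked [simp]: "reflect p \<in> linked \<longleftrightarrow> p \<in> linked"
  by (cases p) (auto simp: reflect_def linked_def)

definition near :: "nat \<Rightarrow> bseq \<times> bseq \<Rightarrow> bseq \<times> bseq \<Rightarrow> bool"
  where "near n p q \<longleftrightarrow> eq_upto n (fst p) (fst q) \<and> eq_upto n (snd p) (snd q)"

lemma near_reflect [simp]: "near n (reflect p) (reflect q) \<longleftrightarrow> near n p q"
  by (auto simp: near_def reflect_def eq_upto_def)

text \<open>
  In every window of length \<open>P\<close>, a common period, both \<open>\<mu>\<close> and \<open>\<alpha>\<close> start at some position. So an
  admissible pair that agrees with a linked pair on the first \<open>2 P\<close> digits cannot leave it later:
  replacing a digit 1 by 0 gives a shift that is smaller than \<open>\<mu>\<close> within its first \<open>P\<close> digits,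
  and replacing a digit 0 by 1 one that is larger than \<open>\<alpha>\<close>.
\<close>

lemma linked_isolated:
  assumes "p \<in> V2'" "p \<in> linked"
  obtains N where "\<And>q. q \<in> V2' \<Longrightarrow> near N p q \<Longrightarrow> q = p"
proof -
  obtain \<mu> \<alpha> where p: "p = (\<mu>, \<alpha>)" by (cases p)
  obtain m n where m: "m \<ge> 1" "suffix m \<mu> = \<alpha>" and n: "n \<ge> 1" "suffix n \<alpha> = \<mu>"
    using assms(2) by (auto simp: p linked_def)
  define P where "P = m + n"
  have "suffix (m + n) \<mu> = \<mu>" "suffix (n + m) \<alpha> = \<alpha>"
    by (metis m(2) n(2) suffix_suffix)+
  then have P: "P > 0" "suffix P \<mu> = \<mu>" "suffix P \<alpha> = \<alpha>"
    using m(1) by (simp_all add: P_def add.commute)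
  have period: "suffix (c * P) \<mu> = \<mu>" "suffix (c * P) \<alpha> = \<alpha>" for c
  proof (induction c)
    case (Suc c)
    then show "suffix (Suc c * P) \<mu> = \<mu>" "suffix (Suc c * P) \<alpha> = \<alpha>"
      using P(2,3) by (metis mult_Suc suffix_suffix)+
  qed simp_all
  \<comment> \<open>The shifts equal to \<open>\<mu>\<close>, and those equal to \<open>\<alpha>\<close>, meet each window \<open>(r - P, r]\<close>.\<close>
  have visits: "\<exists>l\<le>r. r < l + P \<and> suffix l x = z"
    if x: "suffix s x = z" "s \<le> P" and r: "r \<ge> P" and z: "z \<in> {\<mu>, \<alpha>}" for x z s r
  proof -
    define c where "c = (r - s) div P"
    have "c * P \<le> r - s" "r - s < c * P + P"
      using dividend_less_div_times[OF P(1), of "r - s"] by (simp_all add: c_def add.commute)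
    then have "s + c * P \<le> r" "r < s + c * P + P"
      using x(2) r by linarith+
    moreover have "suffix (s + c * P) x = z"
      using x(1) z period[of c] by (metis empty_iff insertE suffix_suffix)
    ultimately show ?thesis by blast
  qed
  have agree: "x' = x"
    if q: "(\<mu>', \<alpha>') \<in> V2'" "near (2 * P) (\<mu>, \<alpha>) (\<mu>', \<alpha>')"
      and x: "(x, x') \<in> {(\<mu>, \<mu>'), (\<alpha>, \<alpha>')}" for \<mu>' \<alpha>' x x'
  proof (rule ccontr)
    assume "x' \<noteq> x"
    then obtain r where r: "eq_upto r x' x" "x' r \<noteq> x r"
      by (rule first_difference)
    have "eq_upto (2 * P) x x'"
      using q(2) x by (auto simp: near_def)
    then have rP: "r \<ge> P"
      using r(2) unfolding eq_upto_def by (cases "r < 2 * P") auto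
    have bounds: "\<mu>' \<preceq> suffix l x'" "suffix l x' \<preceq> \<alpha>'" for l
      using q(1) x by (auto simp: V2'_iff)
    have near: "\<mu>' t = \<mu> t" "\<alpha>' t = \<alpha> t" if "t < P" for t
      using q(2) that by (auto simp: near_def eq_upto_def)
    have hits: "\<exists>s\<le>P. suffix s x = \<mu>" "\<exists>s\<le>P. suffix s x = \<alpha>"
    proof -
      have "suffix 0 \<mu> = \<mu>" "suffix 0 \<alpha> = \<alpha>" "m \<le> P" "n \<le> P" "0 \<le> P"
        by (simp_all add: P_def)
      moreover have "x = \<mu> \<or> x = \<alpha>"
        using x by blast
      ultimately show "\<exists>s\<le>P. suffix s x = \<mu>" "\<exists>s\<le>P. suffix s x = \<alpha>"
        using m(2) n(2) by blast+
    qed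
    show False
    proof (cases "x r")
      case True
      obtain s where "s \<le> P" "suffix s x = \<mu>"
        using hits(1) by blast
      then obtain l where l: "l \<le> r" "r < l + P" "suffix l x = \<mu>"
        using visits[of s x \<mu> r] rP by blast
      have xl: "x (l + t) = \<mu> t" for t
        using fun_cong[OF l(3), of t] by simp
      have "suffix l x' \<prec> \<mu>'"
        unfolding lex_less_iff
      proof (intro exI[of _ "r - l"] conjI)
        have "x' (l + t) = \<mu>' t" if "t < r - l" for t
          using r(1) near(1)[of t] l(1,2) xl[of t] that by (simp add: eq_upto_def)
        then show "eq_upto (r - l) (suffix l x') \<mu>'"
          by (simp add: eq_upto_def)
        show "\<not> suffix l x' (r - l)" "\<mu>' (r - l)"
          using True r(2) l(1,2) near(1)[of "r - l"] xl[of "r - l"] by auto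
      qed
      then show False
        using bounds not_lex_le by blast
    next
      case False
      obtain s where "s \<le> P" "suffix s x = \<alpha>"
        using hits(2) by blast
      then obtain l where l: "l \<le> r" "r < l + P" "suffix l x = \<alpha>"
        using visits[of s x \<alpha> r] rP by blast
      have xl: "x (l + t) = \<alpha> t" for t
        using fun_cong[OF l(3), of t] by simp
      have "\<alpha>' \<prec> suffix l x'"
        unfolding lex_less_iff
      proof (intro exI[of _ "r - l"] conjI)
        have "\<alpha>' t = x' (l + t)" if "t < r - l" for t
          using r(1) near(2)[of t] l(1,2) xl[of t] that by (simp add: eq_upto_def)
        then show "eq_upto (r - l) \<alpha>' (suffix l x')"
          by (simp add: eq_upto_def)
        show "suffix l x' (r - l)" "\<not> \<alpha>' (r - l)"
          using False r(2) l(1,2) near(2)[of "r - l"] xl[of "r - l"] by auto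
      qed
      then show False
        using bounds not_lex_le by blast
    qed
  qed
  show thesis
  proof (rule that[of "2 * P"])
    fix q
    assume q: "q \<in> V2'" "near (2 * P) p q"
    obtain \<mu>' \<alpha>' where q': "q = (\<mu>', \<alpha>')" by (cases q)
    show "q = p"
      using agree[of \<mu>' \<alpha>' \<mu> \<mu>'] agree[of \<mu>' \<alpha>' \<alpha> \<alpha>'] q by (simp add: p q')
  qed
qed

section \<open>Substitution of words into sequences\<close>

function subst_word :: "('a \<Rightarrow> 'b list) \<Rightarrow> 'a word \<Rightarrow> 'b word" where
  "subst_word B c t =
    (if B (c 0) = [] then undefined
     else if t < length (B (c 0)) then B (c 0) ! t
     else subst_word B (suffix 1 c) (t - length (B (c 0))))"
  by pat_completeness auto
termination
proof (relation "Wellfounded.measure (\<lambda>(B, c, t). t)")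
  fix B :: "'a \<Rightarrow> 'b list" and c :: "'a word" and t :: nat
  assume "B (c 0) \<noteq> []" "\<not> t < length (B (c 0))"
  then have "0 < length (B (c 0))" "length (B (c 0)) \<le> t"
    by simp_all
  then have "t - length (B (c 0)) < t"
    by linarith
  then show "((B, suffix 1 c, t - length (B (c 0))), B, c, t) \<in> Wellfounded.measure (\<lambda>(B, c, t). t)"
    by simp
qed simp

declare subst_word.simps [simp del]

lemma subst_word_unfold:
  assumes "B (c 0) \<noteq> []"
  shows "subst_word B c = B (c 0) \<frown> subst_word B (suffix 1 c)"
  using assms by (auto simp: fun_eq_iff subst_word.simps[of B c] conc_def)

section \<open>Admissible pairs built from prefixes\<close>

text \<open>
  At position \<open>k\<close> the longest match of \<open>\<alpha>\<close> with a prefix of \<open>\<mu>\<close>, which starts at \<open>j\<close>, breaks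
  off. All shorter matches that are still alive break off there too. The word up to \<open>j\<close> may
  therefore be continued by \<open>\<mu>\<close> as well as by \<open>\<alpha>\<close>. The index \<open>i\<close> is the start of the longest
  match of \<open>\<mu>\<close> with a prefix of \<open>\<alpha>\<close> that is alive at \<open>k + 1\<close>. The length \<open>k + 1\<close> for \<open>i\<close>
  and for the longer of the two prefixes of \<open>\<alpha>\<close> is chosen such that every comparison inside a
  word is decided by digits on which all the sequences formed below agree with \<open>\<mu>\<close> or \<open>\<alpha>\<close>.
\<close>

locale admissible_words =
  fixes \<mu> \<alpha> :: bseq and i j k :: nat
  assumes V: "(\<mu>, \<alpha>) \<in> V2'"
    and k_pos: "0 < k" and i_le: "i \<le> Suc k" and j_le: "j \<le> k"
    and i_match: "eq_upto (Suc k - i) (suffix i \<mu>) \<alpha>"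
    and i_least: "\<And>l. l < i \<Longrightarrow> \<not> eq_upto (Suc k - l) (suffix l \<mu>) \<alpha>"
    and j_match: "eq_upto (k - j) (suffix j \<alpha>) \<mu>"
    and j_least: "\<And>l. l < j \<Longrightarrow> \<not> eq_upto (k - l) (suffix l \<alpha>) \<mu>"
    and break: "\<alpha> k" "\<not> \<mu> (k - j)"
begin

definition head :: "bool \<Rightarrow> bool list"
  where "head b = prefix (if b then Suc k else j) \<alpha>"

definition code :: "bseq \<Rightarrow> bseq"
  where "code = subst_word (\<lambda>b. head b @ prefix i \<mu>)"

definition lower :: "bseq \<Rightarrow> bseq"
  where "lower c = prefix i \<mu> \<frown> code c"

lemma digit0: "\<not> \<mu> 0" "\<alpha> 0"
  using V by (auto simp: V2'_iff)

lemma bounds: "\<mu> \<preceq> suffix l \<mu>" "suffix l \<mu> \<preceq> \<alpha>" "\<mu> \<preceq> suffix l \<alpha>" "suffix l \<alpha> \<preceq> \<alpha>"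
  using V by (auto simp: V2'_iff)

lemma i_pos: "0 < i"
  using i_match digit0 by (cases i) (auto simp: eq_upto_def)

lemma j_pos: "0 < j"
  using j_match digit0 k_pos by (cases j) (auto simp: eq_upto_def)

lemma length_head: "length (head b) = (if b then Suc k else j)"
  by (simp add: head_def)

lemma head_nonempty: "0 < length (head b)"
  using j_pos by (simp add: length_head)

lemma code_unfold: "code c = head (c 0) \<frown> lower (suffix 1 c)"
  unfolding lower_def code_def
  by (subst subst_word_unfold) (use head_nonempty in auto)

lemma code_head: "t < length (head (c 0)) \<Longrightarrow> code c t = \<alpha> t"
  by (subst code_unfold) (simp add: head_def)

lemma code_tail: "length (head (c 0)) \<le> r \<Longrightarrow>
    suffix r (code c) = suffix (r - length (head (c 0))) (lower (suffix 1 c))"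
  by (subst code_unfold) simp

lemma lower_head: "t < i \<Longrightarrow> lower c t = \<mu> t"
  by (simp add: lower_def)

lemma lower_tail: "i \<le> r \<Longrightarrow> suffix r (lower c) = suffix (r - i) (code c)"
  by (simp add: lower_def)

lemma code_tail_nth: "length (head (c 0)) \<le> t \<Longrightarrow>
    code c t = lower (suffix 1 c) (t - length (head (c 0)))"
  by (subst code_unfold) simp

lemma lower_tail_nth: "i \<le> t \<Longrightarrow> lower c t = code c (t - i)"
  by (simp add: lower_def)

text \<open>
  Cutting \<open>\<mu>\<close> at \<open>i\<close> and continuing with \<open>code c\<close> loses nothing up to position \<open>k\<close>, as \<open>\<mu>\<close>
  itself follows \<open>\<alpha>\<close> from \<open>i\<close> on; cutting \<open>\<alpha>\<close> at \<open>j\<close> and continuing with \<open>lower\<close> loses nothing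
  before \<open>k\<close>, as \<open>\<alpha>\<close> itself follows \<open>\<mu>\<close> there. The digit at \<open>k\<close> then shows which prefix of \<open>\<alpha>\<close>
  was used. The two facts depend on each other at smaller positions.
\<close>

lemma lower_prefix_aux:
  "t \<le> k \<Longrightarrow> lower c t = \<mu> t \<and> code c t = (if t < k then \<alpha> t else c 0)"
proof (induction t arbitrary: c rule: less_induct)
  case (less t)
  have "lower c t = \<mu> t"
  proof (cases "t < i")
    case False
    then have "lower c t = code c (t - i)"
      by (simp add: lower_tail_nth)
    also have "\<dots> = \<alpha> (t - i)"
      using less.IH[of "t - i" c] less.prems False i_pos by auto
    also have "\<dots> = \<mu> t"
    proof -
      have "t - i < Suc k - i" "i + (t - i) = t"
        using False less.prems by linarith+
      then show ?thesis
        using i_match unfolding eq_upto_def suffix_nth by metis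
    qed
    finally show ?thesis .
  qed (simp add: lower_head)
  moreover have "code c t = (if t < k then \<alpha> t else c 0)"
  proof (cases "t < length (head (c 0))")
    case True
    then have "t = k \<Longrightarrow> c 0"
      using j_le by (auto simp: length_head split: if_splits)
    then show ?thesis
      using code_head[of t c, OF True] break(1) less.prems by (cases "t = k") auto
  next
    case False
    then have c: "\<not> c 0" and t: "j \<le> t"
      using less.prems by (auto simp: length_head split: if_splits)
    have "code c t = lower (suffix 1 c) (t - j)"
      using code_tail_nth[of c t] c t by (simp add: length_head)
    also have "\<dots> = \<mu> (t - j)"
      using less.IH[of "t - j"] less.prems t j_pos by auto
    also have "\<dots> = (if t < k then \<alpha> t else c 0)"
    proof (cases "t < k")
      case True
      then have "t - j < k - j"
        using t by linarith
      then have "\<alpha> (j + (t - j)) = \<mu> (t - j)"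
        using j_match unfolding eq_upto_def suffix_nth by blast
      then show ?thesis
        using True t by simp
    qed (use break c less.prems in auto)
    finally show ?thesis .
  qed
  ultimately show ?case ..
qed

lemma lower_prefix: "t \<le> k \<Longrightarrow> lower c t = \<mu> t"
  using lower_prefix_aux by blast

lemma code_prefix: "t < k \<Longrightarrow> code c t = \<alpha> t"
  using lower_prefix_aux[of t c] by simp

lemma code_branch: "code c k = c 0"
  using lower_prefix_aux[of k c] by simp

lemma code_prefix_1: "c 0 \<Longrightarrow> t \<le> k \<Longrightarrow> code c t = \<alpha> t"
  using code_prefix code_branch break by (metis le_neq_implies_less)

lemma lower_less_code: "lower c \<prec> code d"
  using lower_prefix[of 0 c] code_prefix[of 0 d] digit0 k_pos by (simp add: lex_less_first_digit)

text \<open>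
  At the first digit where \<open>c\<close> and \<open>d\<close> differ, the sequences \<open>code c\<close> and \<open>code d\<close> have just
  completed the same words, and \<open>k\<close> digits later they branch like \<open>c\<close> and \<open>d\<close>.
\<close>

lemma code_strict_mono:
  assumes "c \<prec> d"
  shows "code c \<prec> code d"
proof -
  have "code c \<prec> code d" if "eq_upto r c d" "\<not> c r" "d r" for r c d
    using that
  proof (induction r arbitrary: c d)
    case 0
    show ?case
      unfolding lex_less_iff
      by (rule exI[of _ k]) (use 0 in \<open>simp add: eq_upto_def code_prefix code_branch\<close>)
  next
    case (Suc r)
    have c0: "c 0 = d 0"
      using Suc.prems(1) by (auto simp: eq_upto_def)
    have IH: "code (suffix 1 c) \<prec> code (suffix 1 d)"
      using Suc.prems by (intro Suc.IH) (auto simp: eq_upto_def)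
    let ?L = "length (head (c 0))"
    show ?case
    proof (rule lex_less_prependI[of "?L + i"])
      show "suffix (?L + i) (code c) \<prec> suffix (?L + i) (code d)"
        using IH c0 by (simp add: code_tail lower_tail)
      show "eq_upto (?L + i) (code c) (code d)"
        unfolding eq_upto_def
        by (subst (1 2) code_unfold) (auto simp: c0 conc_def lower_def)
    qed
  qed
  then show ?thesis
    using assms unfolding lex_less_iff by blast
qed

lemma lower_strict_mono: "c \<prec> d \<Longrightarrow> lower c \<prec> lower d"
  by (rule lex_less_prependI[of i])
    (simp_all add: code_strict_mono lower_tail lower_head eq_upto_def)

lemma \<mu>_suffix_less: "l < i \<Longrightarrow> lex_less_upto (Suc k - l) (suffix l \<mu>) \<alpha>"
  using bounds i_least lex_le_imp_lex_less_upto by blast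

lemma less_\<alpha>_suffix_before: "l < j \<Longrightarrow> lex_less_upto (k - l) \<mu> (suffix l \<alpha>)"
  using bounds j_least lex_le_imp_lex_less_upto eq_upto_commute by blast

text \<open>
  For \<open>l \<ge> j\<close> a match of \<open>suffix l \<alpha>\<close> with \<open>\<mu>\<close> that is alive at \<open>k\<close> is part of the match
  starting at \<open>j\<close>, so \<open>\<mu>\<close> repeats its own beginning from \<open>l - j\<close> on. As \<open>\<mu>\<close> is its own smallest
  shift and has the digit 0 at \<open>k - j\<close>, it also has the digit 0 at \<open>k - l\<close>, whereas \<open>\<alpha>\<close> has
  the digit 1 at \<open>k\<close>.
\<close>

lemma less_\<alpha>_suffix:
  assumes "l \<le> k"
  shows "lex_less_upto (Suc k - l) \<mu> (suffix l \<alpha>)"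
proof (cases "eq_upto (k - l) (suffix l \<alpha>) \<mu>")
  case False
  then have "\<not> eq_upto (Suc k - l) \<mu> (suffix l \<alpha>)"
    by (meson diff_le_mono eq_upto_commute eq_upto_mono lessI less_imp_le)
  then show ?thesis
    using bounds lex_le_imp_lex_less_upto by blast
next
  case True
  then have l: "j \<le> l"
    using j_least by (meson not_le_imp_less)
  have "eq_upto (k - l) (suffix (l - j) \<mu>) \<mu>"
    unfolding eq_upto_def
  proof (intro allI impI)
    fix t
    assume t: "t < k - l"
    then have "l - j + t < k - j"
      using l by linarith
    then have "\<alpha> (j + (l - j + t)) = \<mu> (l - j + t)" "\<alpha> (l + t) = \<mu> t"
      using j_match True t unfolding eq_upto_def suffix_nth by blast+
    moreover have "j + (l - j + t) = l + t"
      using l by simp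
    ultimately show "suffix (l - j) \<mu> t = \<mu> t"
      by (simp only: suffix_nth)
  qed
  then have "\<mu> (k - l) \<Longrightarrow> suffix (l - j) \<mu> (k - l)"
    using bounds(1) lex_le_next_digit eq_upto_commute by blast
  then have "\<not> \<mu> (k - l)"
    using break l assms by auto
  then show ?thesis
    using True break assms unfolding lex_less_upto_def
    by (intro exI[of _ "k - l"]) (auto simp: eq_upto_commute)
qed

context
  fixes m a :: bseq
  assumes m0: "\<not> m 0" and a0: "a 0"
begin

definition strictly_between :: "bseq \<Rightarrow> bool"
  where "strictly_between x \<longleftrightarrow> lower m \<prec> x \<and> x \<prec> code a"

text \<open>
  No match with \<open>\<alpha>\<close> that starts before \<open>i\<close> is alive at \<open>k + 1\<close>, which gives the upper bound. If
  the shift agrees with \<open>\<mu>\<close> up to \<open>k + 1\<close>, the comparison from below is postponed to the end of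
  the word \<open>u\<close>: there the shift goes on with \<open>code c\<close>, and \<open>lower m\<close> with its own shift by
  \<open>i - l\<close>. Applying the first argument to the latter shows that it is the smaller of the two.
\<close>

lemma lower_interior:
  assumes l: "0 < l" "l < i"
  shows "strictly_between (suffix l (lower c))"
  unfolding strictly_between_def
proof
  show "suffix l (lower c) \<prec> code a"
    by (rule lex_less_upto_imp_lex_less[OF \<mu>_suffix_less[OF l(2)]])
      (auto simp: lower_prefix code_prefix_1[of a, OF a0])
  show "lower m \<prec> suffix l (lower c)"
  proof (cases "eq_upto (Suc k - l) \<mu> (suffix l \<mu>)")
    case False
    then have "lex_less_upto (Suc k - l) \<mu> (suffix l \<mu>)"
      using bounds lex_le_imp_lex_less_upto by blast
    then show ?thesis
      by (rule lex_less_upto_imp_lex_less) (auto simp: lower_prefix)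
  next
    case True
    have "lex_less_upto (Suc k - (i - l)) (suffix (i - l) \<mu>) \<alpha>"
      using l by (intro \<mu>_suffix_less) auto
    then have "suffix (i - l) (lower m) \<prec> code c"
      by (rule lex_less_upto_imp_lex_less) (use l in \<open>auto simp: lower_prefix code_prefix\<close>)
    then have "suffix (i - l) (lower m) \<prec> suffix (i - l) (suffix l (lower c))"
      using l by (simp add: lower_tail)
    moreover have "eq_upto (i - l) (lower m) (suffix l (lower c))"
      using True l i_le unfolding eq_upto_def by (auto simp: lower_head)
    ultimately show ?thesis
      by (rule lex_less_prependI[rotated])
  qed
qed

text \<open>
  The matches with \<open>\<mu>\<close> that start inside the shorter word have ended before \<open>k\<close>, and in the longer
  word the digit 1 of \<open>\<alpha>\<close> at \<open>k\<close> ends them. After the shorter word, the digit 0 put at \<open>k\<close> ends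
  all matches with \<open>\<alpha>\<close>, since \<open>\<alpha>\<close> is its own largest shift. In the longer word, a match with
  \<open>\<alpha>\<close> that survives \<open>k\<close> is decided at the end of the word, where the shift starts
  again with \<open>lower\<close> while \<open>code a\<close> goes on with a proper shift of its beginning.
\<close>

lemma code_interior:
  assumes l: "0 < l" "l < length (head (c 0))"
  shows "strictly_between (suffix l (code c))"
proof (cases "c 0")
  case True
  then have lk: "l \<le> k"
    using l by (simp add: length_head)
  have "lower m \<prec> suffix l (code c)"
    by (rule lex_less_upto_imp_lex_less[OF less_\<alpha>_suffix[OF lk]])
      (auto simp: lower_prefix code_prefix_1[of c, OF True])
  moreover have "suffix l (code c) \<prec> code a"
  proof (cases "eq_upto (Suc k - l) (suffix l \<alpha>) \<alpha>")
    case False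
    then have "lex_less_upto (Suc k - l) (suffix l \<alpha>) \<alpha>"
      using bounds lex_le_imp_lex_less_upto by blast
    then show ?thesis
      by (rule lex_less_upto_imp_lex_less) (auto simp: code_prefix_1[of a, OF a0] code_prefix_1[of c, OF True])
  next
    case eq: True
    let ?q = "Suc k - l"
    have "?q \<le> k"
      using l by simp
    from less_\<alpha>_suffix[OF this] have "lower (suffix 1 c) \<prec> suffix ?q (code a)"
      by (rule lex_less_upto_imp_lex_less) (auto simp: lower_prefix code_prefix_1[of a, OF a0])
    then have "suffix ?q (suffix l (code c)) \<prec> suffix ?q (code a)"
      using lk code_tail[of c "Suc k"] True by (simp add: length_head)
    moreover have "eq_upto ?q (suffix l (code c)) (code a)"
      using eq unfolding eq_upto_def by (auto simp: code_prefix_1[of a, OF a0] code_prefix_1[of c, OF True])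
    ultimately show ?thesis
      by (rule lex_less_prependI[rotated])
  qed
  ultimately show ?thesis
    by (simp add: strictly_between_def)
next
  case False
  then have lj: "l < j"
    using l by (simp add: length_head)
  have "lower m \<prec> suffix l (code c)"
    by (rule lex_less_upto_imp_lex_less[OF less_\<alpha>_suffix_before[OF lj]])
      (auto simp: lower_prefix code_prefix)
  moreover have "suffix l (code c) \<prec> code a"
  proof (cases "eq_upto (k - l) (suffix l \<alpha>) \<alpha>")
    case neq: False
    then have "lex_less_upto (k - l) (suffix l \<alpha>) \<alpha>"
      using bounds lex_le_imp_lex_less_upto by blast
    then show ?thesis
      by (rule lex_less_upto_imp_lex_less) (auto simp: code_prefix)
  next
    case eq: True
    have lk: "l < k"
      using lj j_le by simp
    then have "\<alpha> (k - l)"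
      using lex_le_next_digit[OF bounds(4) eq] break by simp
    then show ?thesis
      unfolding lex_less_iff using eq lk code_branch[of c] False l
      by (intro exI[of _ "k - l"]) (auto simp: eq_upto_def code_prefix)
  qed
  ultimately show ?thesis
    by (simp add: strictly_between_def)
qed

text \<open>
  The side conditions \<open>0 < s\<close> record that a proper shift at a word boundary comes from a proper
  shift of \<open>c\<close>. They are what allows strict inequalities for \<open>m\<close> and \<open>a\<close> to be passed on.
\<close>

lemma suffix_code_cases:
  "(\<exists>s. suffix r (code c) = code (suffix s c) \<and> (0 < r \<longrightarrow> 0 < s)) \<or>
   (\<exists>s>0. suffix r (code c) = lower (suffix s c)) \<or> strictly_between (suffix r (code c))"
proof (induction r arbitrary: c rule: less_induct)
  case (less r)
  let ?L = "length (head (c 0))"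
  consider "r = 0" | "0 < r" "r < ?L" | "r = ?L" | "?L < r" "r < ?L + i" | "?L + i \<le> r"
    by linarith
  then show ?case
  proof cases
    case 1
    then show ?thesis by (metis suffix_0 less_irrefl)
  next
    case 2
    then show ?thesis using code_interior[of r c] by blast
  next
    case 3
    then have "suffix r (code c) = lower (suffix 1 c)"
      by (simp add: code_tail)
    then show ?thesis by (metis zero_less_one)
  next
    case 4
    then have "strictly_between (suffix (r - ?L) (lower (suffix 1 c)))"
      by (intro lower_interior) auto
    moreover have "suffix r (code c) = suffix (r - ?L) (lower (suffix 1 c))"
      using 4 by (intro code_tail) simp
    ultimately show ?thesis by metis
  next
    case 5
    let ?r = "r - ?L - i"
    have eq: "suffix r (code c) = suffix ?r (code (suffix 1 c))"
      using 5 by (simp add: code_tail lower_tail)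
    have "?r < r"
      using 5 i_pos by simp
    from less.IH[OF this, of "suffix 1 c"] show ?thesis
      unfolding eq suffix_suffix by (metis add_pos_nonneg zero_less_one zero_le)
  qed
qed

lemma suffix_lower_cases:
  assumes "0 < r"
  shows "(\<exists>s. suffix r (lower c) = code (suffix s c)) \<or>
    (\<exists>s>0. suffix r (lower c) = lower (suffix s c)) \<or> strictly_between (suffix r (lower c))"
proof (cases "r < i")
  case True
  then show ?thesis
    using assms by (simp add: lower_interior)
next
  case False
  then show ?thesis
    using suffix_code_cases[of "r - i" c] by (auto simp: lower_tail)
qed

lemma lower_less_suffix_lower:
  assumes "\<And>s. 0 < s \<Longrightarrow> m \<prec> suffix s m" "0 < r"
  shows "lower m \<prec> suffix r (lower m)"
  using suffix_lower_cases[OF assms(2), of m] lower_less_code lower_strict_mono assms(1)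
  by (auto simp: strictly_between_def)

lemma code_pair_U2':
  assumes "(m, a) \<in> U2'"
  shows "(lower m, code a) \<in> U2'"
proof -
  have U: "m \<prec> suffix s m" "suffix s m \<prec> a" "m \<prec> suffix s a" "suffix s a \<prec> a" if "0 < s" for s
    using assms that by (auto simp: U2'_iff Suc_le_eq)
  have ma: "suffix s m \<prec> a" for s
    using U m0 a0 by (cases s) (auto intro: lex_less_first_digit)
  have "lower m \<prec> suffix r (lower m) \<and> suffix r (lower m) \<prec> code a \<and>
      lower m \<prec> suffix r (code a) \<and> suffix r (code a) \<prec> code a" if "0 < r" for r
    using suffix_lower_cases[OF that, of m] suffix_code_cases[of r a] that U ma
      lower_less_code code_strict_mono lower_strict_mono
    by (auto simp: strictly_between_def)
  then show ?thesis
    using lower_prefix[of 0 m] code_prefix[of 0 a] digit0 k_pos by (simp add: U2'_iff)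
qed

lemma code_pair_V2':
  assumes "(m, a) \<in> V2'"
  shows "(lower m, code a) \<in> V2'"
proof -
  have code_mono: "x \<preceq> y \<Longrightarrow> code x \<preceq> code y" and lower_mono: "x \<preceq> y \<Longrightarrow> lower x \<preceq> lower y" for x y
    using code_strict_mono lower_strict_mono by (auto simp: lex_le_def)
  have V: "m \<preceq> suffix s m" "suffix s m \<preceq> a" "m \<preceq> suffix s a" "suffix s a \<preceq> a" for s
    using assms by (auto simp: V2'_iff)
  have le: "lower x \<preceq> code y" for x y
    using lower_less_code by (simp add: lex_le_def)
  have "lower m \<preceq> suffix r (lower m) \<and> suffix r (lower m) \<preceq> code a" for r
  proof (cases "r = 0")
    case False
    then show ?thesis
      using suffix_lower_cases[of r m] V le code_mono lower_mono
      by (auto simp: strictly_between_def lex_less_imp_le)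
  qed (simp add: le)
  moreover have "lower m \<preceq> suffix r (code a) \<and> suffix r (code a) \<preceq> code a" for r
    using suffix_code_cases[of r a] V le code_mono lower_mono
    by (auto simp: strictly_between_def lex_less_imp_le)
  ultimately show ?thesis
    using lower_prefix[of 0 m] code_prefix[of 0 a] digit0 k_pos by (simp add: V2'_iff)
qed

end

lemma code_reaches_code: "\<exists>r\<ge>s. suffix r (code c) = code (suffix s c)"
proof (induction s arbitrary: c)
  case 0
  show ?case by (rule exI[of _ 0]) simp
next
  case (Suc s)
  let ?L = "length (head (c 0))"
  obtain r where r: "r \<ge> s" "suffix r (code (suffix 1 c)) = code (suffix (Suc s) c)"
    using Suc[of "suffix 1 c"] by (metis plus_1_eq_Suc suffix_suffix)
  have "suffix (?L + i + r) (code c) = code (suffix (Suc s) c)"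
    using r(2) by (simp add: code_tail lower_tail)
  moreover have "?L + i + r \<ge> Suc s"
    using r(1) i_pos by simp
  ultimately show ?case by blast
qed

lemma code_reaches_lower:
  assumes "0 < s"
  shows "\<exists>r\<ge>s. suffix r (code c) = lower (suffix s c)"
proof -
  define d where "d = suffix (s - 1) c"
  obtain r where r: "r \<ge> s - 1" "suffix r (code c) = code d"
    using code_reaches_code unfolding d_def by blast
  let ?L = "length (head (d 0))"
  have "suffix (r + ?L) (code c) = suffix ?L (code d)"
    using r(2) by (metis suffix_suffix)
  also have "\<dots> = lower (suffix s c)"
    using assms by (simp add: code_tail) (simp add: d_def)
  finally show ?thesis
    using r(1) assms head_nonempty[of "d 0"] by (intro exI[of _ "r + ?L"] conjI) linarith+
qed

lemma code_pair_linked: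
  assumes "(m, a) \<in> linked"
  shows "(lower m, code a) \<in> linked"
proof -
  obtain s t where s: "s \<ge> 1" "suffix s m = a" and t: "t \<ge> 1" "suffix t a = m"
    using assms by (auto simp: linked_def)
  obtain r where r: "suffix r (code m) = code a" "r \<ge> s"
    using code_reaches_code[of s m] s by auto
  obtain r' where r': "suffix r' (code a) = lower m" "r' \<ge> t"
    using code_reaches_lower[of t a] t by auto
  have "suffix (i + r) (lower m) = code a"
    using r by (simp add: lower_tail)
  then show ?thesis
    using r r' s t unfolding linked_def mem_Collect_eq case_prod_conv
    by (metis le_trans trans_le_add2)
qed

lemma code_pair_near: "a 0 \<Longrightarrow> N \<le> k \<Longrightarrow> near N (\<mu>, \<alpha>) (lower m, code a)"
  by (auto simp: near_def eq_upto_def lower_prefix code_prefix_1)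

end

section \<open>Approximation of unlinked pairs\<close>

text \<open>
  Starting from any length, the longest match of \<open>\<alpha>\<close> with \<open>\<mu>\<close> ends at some finite position, as
  no shift of \<open>\<alpha>\<close> equals \<open>\<mu>\<close>; this position serves as \<open>k\<close>. The length is \<open>N + 1\<close> rather than
  \<open>N\<close> to have \<open>k > 0\<close>.
\<close>

lemma admissible_words_exist:
  assumes V: "(\<mu>, \<alpha>) \<in> V2'" and unreached: "\<And>n. suffix n \<alpha> \<noteq> \<mu>"
  obtains i j k where "N \<le> k" "admissible_words \<mu> \<alpha> i j k"
proof -
  let ?P = "\<lambda>l. eq_upto (Suc N - l) (suffix l \<alpha>) \<mu>"
  define j where "j = (LEAST l. ?P l)"
  have P: "?P (Suc N)"
    by (simp add: eq_upto_def)
  then have j: "?P j" "j \<le> Suc N"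
    unfolding j_def by (rule LeastI, rule Least_le)
  have j_least: "\<not> ?P l" if "l < j" for l
    using that unfolding j_def by (rule not_less_Least)
  obtain r where r: "eq_upto r (suffix j \<alpha>) \<mu>" "suffix j \<alpha> r \<noteq> \<mu> r"
    using first_difference[OF unreached[of j]] .
  have "\<mu> \<preceq> suffix j \<alpha>"
    using V by (simp add: V2'_iff)
  moreover have "eq_upto r \<mu> (suffix j \<alpha>)"
    using r(1) by (simp only: eq_upto_commute)
  ultimately have "\<mu> r \<Longrightarrow> suffix j \<alpha> r"
    by (rule lex_le_next_digit)
  then have break: "suffix j \<alpha> r" "\<not> \<mu> r"
    using r(2) by blast+
  define k where "k = j + r"
  have "\<not> r < Suc N - j"
    using j(1) r(2) by (auto simp: eq_upto_def)
  then have k: "Suc N \<le> k"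
    using j(2) by (simp add: k_def)
  let ?Q = "\<lambda>l. eq_upto (Suc k - l) (suffix l \<mu>) \<alpha>"
  define i where "i = (LEAST l. ?Q l)"
  have Q: "?Q (Suc k)"
    by (simp add: eq_upto_def)
  have "admissible_words \<mu> \<alpha> i j k"
  proof
    show "(\<mu>, \<alpha>) \<in> V2'" by (rule V)
    show "0 < k" using k by simp
    show "i \<le> Suc k" using Q unfolding i_def by (rule Least_le)
    show "j \<le> k" by (simp add: k_def)
    show "?Q i" using Q unfolding i_def by (rule LeastI)
    show "\<not> ?Q l" if "l < i" for l
      using that unfolding i_def by (rule not_less_Least)
    show "eq_upto (k - j) (suffix j \<alpha>) \<mu>" "\<alpha> k" "\<not> \<mu> (k - j)"
      using r(1) break by (simp_all add: k_def)
    show "\<not> eq_upto (k - l) (suffix l \<alpha>) \<mu>" if "l < j" for l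
      using j_least[OF that] eq_upto_mono[OF _ diff_le_mono[OF k, of l]] by blast
  qed
  then show thesis
    using k that[of k i j] by simp
qed

text \<open>
  The sequence \<open>001010\<dots>\<close>. It contains \<open>00\<close> only at its start and never \<open>11\<close>, and its reflection
  \<open>110101\<dots>\<close> has the opposite properties.
\<close>

definition sparse :: bseq
  where "sparse t \<longleftrightarrow> 2 \<le> t \<and> even t"

lemma lex_less_second_digit: "\<lbrakk>x 0 = y 0; \<not> x 1; y 1\<rbrakk> \<Longrightarrow> x \<prec> y"
  unfolding lex_less_iff by (rule exI[of _ 1]) (simp add: eq_upto_def)

lemma sparse_U2': "(sparse, Not \<circ> sparse) \<in> U2'"
proof -
  have "sparse \<prec> suffix n sparse \<and> suffix n sparse \<prec> Not \<circ> sparse \<and>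
    sparse \<prec> Not \<circ> suffix n sparse" if "n \<ge> 1" for n
  proof (cases "even n")
    case True
    then have "2 \<le> n"
      using that by (cases "n = 1") auto
    with True show ?thesis
      by (intro conjI lex_less_first_digit[of sparse "suffix n sparse"]
          lex_less_second_digit[of "suffix n sparse"] lex_less_second_digit[of sparse "Not \<circ> suffix n sparse"])
        (simp_all add: sparse_def)
  next
    case False
    with that show ?thesis
      by (intro conjI lex_less_second_digit[of sparse "suffix n sparse"]
          lex_less_first_digit[of "suffix n sparse"] lex_less_first_digit[of sparse "Not \<circ> suffix n sparse"])
        (simp_all add: sparse_def)
  qed
  then show ?thesis
    by (auto simp: U2'_iff sparse_def)
qed

text \<open>
  The sequence \<open>00 1c\<^sub>0 1c\<^sub>1 1c\<^sub>2\<dots>\<close>, which contains \<open>00\<close> only at its start. Together with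
  \<open>111\<dots>\<close> these sequences form a Cantor family of unlinked pairs outside \<open>U2'\<close>.
\<close>

definition interleave :: "bseq \<Rightarrow> bseq"
  where "interleave c t \<longleftrightarrow> 2 \<le> t \<and> (even t \<or> c ((t - 3) div 2))"

lemma interleave_less_suffix:
  assumes "n \<ge> 1"
  shows "interleave c \<prec> suffix n (interleave c)"
proof (cases "interleave c n")
  case True
  then show ?thesis
    by (intro lex_less_first_digit) (simp_all add: interleave_def)
next
  case False
  then have "interleave c (n + 1)"
    using assms by (auto simp: interleave_def)
  then show ?thesis
    using False by (intro lex_less_second_digit) (simp_all add: interleave_def)
qed

lemma lex_le_all_True: "x \<preceq> (\<lambda>_. True)"
  using not_lex_le[of x "\<lambda>_. True"] by (auto simp: lex_less_iff)

lemma suffix_all_True: "suffix n (\<lambda>_. True) = (\<lambda>_. True)"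
  by (simp add: fun_eq_iff)

lemma interleave_V2': "(interleave c, \<lambda>_. True) \<in> V2'"
proof -
  have "interleave c \<preceq> suffix n (interleave c)" for n
    using interleave_less_suffix[of n c] by (cases n) (auto intro: lex_less_imp_le)
  then show ?thesis
    unfolding V2'_iff suffix_all_True using lex_le_all_True by (simp add: interleave_def)
qed

lemma interleave_boundary: "(interleave c, \<lambda>_. True) \<in> V2' - linked - U2'"
  using interleave_V2' not_linked_if_aperiodic[OF interleave_less_suffix]
    periodic_not_U2'[OF suffix_all_True order_refl] by blast

lemma inj_interleave: "inj interleave"
proof
  fix c d
  assume eq: "interleave c = interleave d"
  show "c = d"
  proof
    fix t
    show "c t = d t"
      using fun_cong[OF eq, of "2 * t + 3"] by (simp add: interleave_def)
  qed
qed

lemma alternating_linked: "(odd, even) \<in> V2' \<inter> linked"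
proof -
  have sw: "suffix n odd = (if even n then odd else even)" "suffix n even = (if even n then even else odd)"
    for n :: nat by (auto simp: fun_eq_iff)
  have le: "odd \<preceq> even"
    by (intro lex_less_imp_le lex_less_first_digit) auto
  have "(odd, even) \<in> V2'"
    by (auto simp: V2'_iff sw le)
  moreover have "(odd, even) \<in> linked"
    unfolding linked_def by (auto simp: sw intro: exI[of _ 1])
  ultimately show ?thesis by blast
qed

lemma approximations_if_unreached:
  assumes "(\<mu>, \<alpha>) \<in> V2'" "\<And>n. suffix n \<alpha> \<noteq> \<mu>"
  shows "\<exists>q\<in>U2'. near N (\<mu>, \<alpha>) q"
    and "\<exists>q\<in>V2' - linked - U2'. near N (\<mu>, \<alpha>) q"
    and "\<exists>q\<in>V2' \<inter> linked. near N (\<mu>, \<alpha>) q"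
proof -
  obtain i j k where k: "N \<le> k" and "admissible_words \<mu> \<alpha> i j k"
    using admissible_words_exist[OF assms] .
  then interpret admissible_words \<mu> \<alpha> i j k by simp
  show "\<exists>q\<in>U2'. near N (\<mu>, \<alpha>) q"
  proof
    show "(lower sparse, code (Not \<circ> sparse)) \<in> U2'"
      by (intro code_pair_U2' sparse_U2') (auto simp: sparse_def)
    show "near N (\<mu>, \<alpha>) (lower sparse, code (Not \<circ> sparse))"
      by (intro code_pair_near k) (auto simp: sparse_def)
  qed
  show "\<exists>q\<in>V2' \<inter> linked. near N (\<mu>, \<alpha>) q"
  proof
    show "(lower odd, code even) \<in> V2' \<inter> linked"
      using alternating_linked by (auto intro: code_pair_V2' code_pair_linked)
    show "near N (\<mu>, \<alpha>) (lower odd, code even)"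
      by (intro code_pair_near k) auto
  qed
  let ?m = "interleave (\<lambda>_. False)" and ?a = "\<lambda>_. True"
  have digits: "\<not> ?m 0" "?a 0"
    by (auto simp: interleave_def)
  show "\<exists>q\<in>V2' - linked - U2'. near N (\<mu>, \<alpha>) q"
  proof
    have "lower ?m \<prec> suffix r (lower ?m)" if "1 \<le> r" for r
      using that interleave_less_suffix
      by (intro lower_less_suffix_lower[where m = ?m and a = ?a, OF digits]) auto
    then have "(lower ?m, code ?a) \<notin> linked"
      by (rule not_linked_if_aperiodic)
    moreover obtain r where "r \<ge> 1" "suffix r (code ?a) = code ?a"
      using code_reaches_code[of 1 ?a] unfolding suffix_all_True by blast
    then have "(lower ?m, code ?a) \<notin> U2'"
      by (intro periodic_not_U2')
    moreover have "(lower ?m, code ?a) \<in> V2'"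
      by (rule code_pair_V2'[where m = ?m and a = ?a, OF digits interleave_V2'])
    ultimately show "(lower ?m, code ?a) \<in> V2' - linked - U2'"
      by blast
    show "near N (\<mu>, \<alpha>) (lower ?m, code ?a)"
      by (intro code_pair_near k) auto
  qed
qed

text \<open>
  If some shift of \<open>\<alpha>\<close> is \<open>\<mu>\<close>, then no shift of \<open>\<mu>\<close> is \<open>\<alpha>\<close>, since the pair is unlinked, and the
  reflected pair satisfies the assumption of the one-sided version.
\<close>

lemma approximations:
  assumes "p \<in> V2' - linked"
  shows "\<exists>q\<in>U2'. near N p q"
    and "\<exists>q\<in>V2' - linked - U2'. near N p q"
    and "\<exists>q\<in>V2' \<inter> linked. near N p q"
proof -
  obtain \<mu> \<alpha> where p: "p = (\<mu>, \<alpha>)" by (cases p)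
  have V: "(\<mu>, \<alpha>) \<in> V2'" and unlinked: "(\<mu>, \<alpha>) \<notin> linked"
    using assms by (auto simp: p)
  have ne: "\<mu> \<noteq> \<alpha>"
    using V by (auto simp: V2'_iff)
  have "(\<exists>q\<in>U2'. near N p q) \<and> (\<exists>q\<in>V2' - linked - U2'. near N p q) \<and>
    (\<exists>q\<in>V2' \<inter> linked. near N p q)"
  proof (cases "\<exists>n. suffix n \<alpha> = \<mu>")
    case False
    then show ?thesis
      using approximations_if_unreached[OF V, of N] unfolding p by blast
  next
    case True
    have "suffix n \<mu> \<noteq> \<alpha>" for n
    proof
      assume n: "suffix n \<mu> = \<alpha>"
      obtain m where m: "suffix m \<alpha> = \<mu>"
        using True by blast
      have "n \<ge> 1" "m \<ge> 1"
        using ne m n by (auto intro!: Suc_leI gr0I)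
      then show False
        using unlinked m n by (auto simp: linked_def)
    qed
    then have "suffix n (Not \<circ> \<mu>) \<noteq> Not \<circ> \<alpha>" for n
      by simp
    moreover have r: "reflect p = (Not \<circ> \<alpha>, Not \<circ> \<mu>)"
      by (simp add: reflect_def p)
    moreover have "(Not \<circ> \<alpha>, Not \<circ> \<mu>) \<in> V2'"
      using V by (metis p r reflect_V2')
    ultimately have reflected: "(\<exists>q\<in>U2'. near N (reflect p) q) \<and>
      (\<exists>q\<in>V2' - linked - U2'. near N (reflect p) q) \<and> (\<exists>q\<in>V2' \<inter> linked. near N (reflect p) q)"
      using approximations_if_unreached[of "Not \<circ> \<alpha>" "Not \<circ> \<mu>" N] by simp
    have transfer: "\<exists>q\<in>X. near N p q"
      if "\<exists>q\<in>X. near N (reflect p) q" "\<And>q. q \<in> X \<Longrightarrow> reflect q \<in> X" for X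
      using that near_reflect[of N p] by (metis reflect_reflect)
    show ?thesis
      using reflected transfer[of U2'] transfer[of "V2' - linked - U2'"] transfer[of "V2' \<inter> linked"] by simp
  qed
  then show "\<exists>q\<in>U2'. near N p q"
    and "\<exists>q\<in>V2' - linked - U2'. near N p q"
    and "\<exists>q\<in>V2' \<inter> linked. near N p q"
    by blast+
qed

section \<open>Topology of the sequence space\<close>

lemma seq_dist_less_iff: "seq_dist x y < (1/2) ^ n \<longleftrightarrow> eq_upto n x y"
proof (cases "x = y")
  case False
  define l where "l = (LEAST i. x i \<noteq> y i)"
  have "\<exists>i. x i \<noteq> y i"
    using False by (simp add: fun_eq_iff)
  then have "x l \<noteq> y l"
    unfolding l_def by (rule LeastI_ex)
  moreover have "x t = y t" if "t < l" for t
    using that not_less_Least unfolding l_def by blast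
  ultimately have "eq_upto n x y \<longleftrightarrow> n \<le> l"
    unfolding eq_upto_def by (meson less_le_trans not_le_imp_less)
  also have "\<dots> \<longleftrightarrow> n < Suc l"
    by auto
  also have "\<dots> \<longleftrightarrow> (1/2 :: real) ^ Suc l < (1/2) ^ n"
    by (simp only: power_strict_decreasing_iff)
  finally show ?thesis
    using False by (simp only: seq_dist_def l_def if_False)
qed (simp add: seq_dist_def)

lemma pair_dist_less_iff: "pair_dist p q < (1/2) ^ n \<longleftrightarrow> near n p q"
  by (simp only: pair_dist_def near_def max_less_iff_conj seq_dist_less_iff)

lemma openin_iff_near:
  "openin Seq2.mtopology S \<longleftrightarrow> (\<forall>p\<in>S. \<exists>n. \<forall>q. near n p q \<longrightarrow> q \<in> S)"
proof -
  have "(\<exists>r>0. Seq2.mball p r \<subseteq> S) \<longleftrightarrow> (\<exists>n. \<forall>q. near n p q \<longrightarrow> q \<in> S)" for p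
  proof
    assume "\<exists>r>0. Seq2.mball p r \<subseteq> S"
    then obtain r where "r > 0" and r: "Seq2.mball p r \<subseteq> S"
      by blast
    then obtain n where "(1/2) ^ n < r"
      using real_arch_pow_inv[of r "1/2"] by auto
    then have "near n p q \<Longrightarrow> q \<in> S" for q
      using r unfolding pair_dist_less_iff[symmetric]
      by (meson Seq2.in_mball UNIV_I less_trans subsetD)
    then show "\<exists>n. \<forall>q. near n p q \<longrightarrow> q \<in> S"
      by blast
  next
    assume "\<exists>n. \<forall>q. near n p q \<longrightarrow> q \<in> S"
    then obtain n where "\<And>q. near n p q \<Longrightarrow> q \<in> S"
      by blast
    then have "Seq2.mball p ((1/2) ^ n) \<subseteq> S"
      unfolding pair_dist_less_iff[symmetric] by auto
    then show "\<exists>r>0. Seq2.mball p r \<subseteq> S"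
      by (intro exI[of _ "(1/2) ^ n"]) simp
  qed
  then show ?thesis
    unfolding Seq2.openin_mtopology by blast
qed

lemma near_refl [simp]: "near n p p"
  by (simp add: near_def)

lemma near_trans: "near n p q \<Longrightarrow> near n q r \<Longrightarrow> near n p r"
  by (simp add: near_def eq_upto_def)

lemma closure_iff_near: "p \<in> Seq2.mtopology closure_of S \<longleftrightarrow> (\<forall>n. \<exists>q\<in>S. near n p q)"
proof
  assume p: "p \<in> Seq2.mtopology closure_of S"
  show "\<forall>n. \<exists>q\<in>S. near n p q"
  proof
    fix n
    have "openin Seq2.mtopology {q. near n p q}"
      unfolding openin_iff_near using near_trans by blast
    then show "\<exists>q\<in>S. near n p q"
      using p unfolding in_closure_of by (metis mem_Collect_eq near_refl)
  qed
next
  assume "\<forall>n. \<exists>q\<in>S. near n p q"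
  then have "\<exists>q. q \<in> S \<and> q \<in> T" if "p \<in> T" "openin Seq2.mtopology T" for T
    using that unfolding openin_iff_near by meson
  then show "p \<in> Seq2.mtopology closure_of S"
    unfolding in_closure_of by simp
qed

text \<open>
  Sets that are open for the metric are open in the product topology, which is compact by
  Tychonoff's theorem.
\<close>

lemma compactin_UNIV: "compactin Seq2.mtopology UNIV"
proof -
  have "compact_space (euclidean :: bool topology)"
    by (simp add: compact_space_def finite_imp_compact)
  then have "compact_space (euclidean :: bseq topology)"
    unfolding euclidean_product_topology[symmetric] compact_space_product_topology by blast
  then have "compact (UNIV :: bseq set)"
    by (simp add: compact_space_def)
  then have "compact (UNIV \<times> UNIV :: (bseq \<times> bseq) set)"
    by (intro compact_Times)
  then have compact: "compact (UNIV :: (bseq \<times> bseq) set)"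
    by simp
  have mtopology_open: "open S" if S: "openin Seq2.mtopology S" for S
  proof -
    have digit: "open {x :: bseq. x t = b}" for t b
      using open_vimage[of "{b}" "\<lambda>x :: bseq. x t"] by (simp add: vimage_def open_discrete)
    have cylinder: "open {q. near n p q}" for n p
    proof -
      have "{q. near n p q} = (\<Inter>t\<in>{..<n}. {x. x t = fst p t} \<times> {x. x t = snd p t})"
        by (rule set_eqI) (simp add: near_def eq_upto_def mem_Times_iff eq_commute ball_conj_distrib lessThan_def)
      then show ?thesis
        by (simp only:) (intro open_INT finite_lessThan ballI open_Times digit)
    qed
    show "open S"
    proof (subst open_subopen, intro ballI)
      fix p
      assume "p \<in> S"
      then obtain n where "\<And>q. near n p q \<Longrightarrow> q \<in> S"
        using S unfolding openin_iff_near by blast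
      then show "\<exists>T. open T \<and> p \<in> T \<and> T \<subseteq> S"
        using cylinder[of n p] by (intro exI[of _ "{q. near n p q}"]) auto
    qed
  qed
  show ?thesis
    unfolding compactin_def
  proof (intro conjI allI impI)
    fix \<U>
    assume "Ball \<U> (openin Seq2.mtopology) \<and> UNIV \<subseteq> \<Union> \<U>"
    then have cover: "UNIV \<subseteq> \<Union> \<U>" "\<And>U. U \<in> \<U> \<Longrightarrow> open U"
      by (simp_all add: mtopology_open)
    obtain \<F> where "\<F> \<subseteq> \<U>" "finite \<F>" "UNIV \<subseteq> \<Union> \<F>"
      by (rule compactE[OF compact cover])
    then show "\<exists>\<F>. finite \<F> \<and> \<F> \<subseteq> \<U> \<and> UNIV \<subseteq> \<Union> \<F>"
      by blast
  qed simp
qed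

section \<open>The closure as the set of unlinked pairs\<close>

text \<open>
  The weak lexicographic order is closed: its failure is visible on finitely many digits.
\<close>

lemma lex_le_limit:
  assumes "\<And>N. \<exists>x' y'. eq_upto N x x' \<and> eq_upto N y y' \<and> x' \<preceq> y'"
  shows "x \<preceq> y"
proof (rule ccontr)
  assume "\<not> x \<preceq> y"
  then obtain r where r: "eq_upto r y x" "\<not> y r" "x r"
    by (auto simp: not_lex_le lex_less_iff)
  obtain x' y' where *: "eq_upto (Suc r) x x'" "eq_upto (Suc r) y y'" "x' \<preceq> y'"
    using assms by blast
  have "y' \<prec> x'"
    unfolding lex_less_iff using r * by (intro exI[of _ r]) (auto simp: eq_upto_def)
  then show False
    using *(3) not_lex_le by blast
qed

lemma closedin_V2': "closedin Seq2.mtopology V2'"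
proof -
  have "p \<in> V2'" if p: "p \<in> Seq2.mtopology closure_of V2'" for p
  proof -
    obtain \<mu> \<alpha> where eq: "p = (\<mu>, \<alpha>)" by (cases p)
    have approx: "\<exists>\<mu>' \<alpha>'. (\<mu>', \<alpha>') \<in> V2' \<and> eq_upto N \<mu> \<mu>' \<and> eq_upto N \<alpha> \<alpha>'" for N
      using p unfolding closure_iff_near eq near_def by (metis fst_conv snd_conv surj_pair)
    have lim: "x \<preceq> y"
      if "\<And>N \<mu>' \<alpha>'. (\<mu>', \<alpha>') \<in> V2' \<Longrightarrow> eq_upto (n + N) \<mu> \<mu>' \<Longrightarrow> eq_upto (n + N) \<alpha> \<alpha>' \<Longrightarrow>
        \<exists>x' y'. eq_upto N x x' \<and> eq_upto N y y' \<and> x' \<preceq> y'" for x y n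
      using approx that by (intro lex_le_limit) meson
    have eq_suffix: "eq_upto N (suffix n x) (suffix n x')" "eq_upto N x x'"
      if "eq_upto (n + N) x x'" for n N x x'
      using that by (auto simp: eq_upto_def)
    have "\<mu> \<preceq> suffix n \<mu>" "suffix n \<mu> \<preceq> \<alpha>" "\<mu> \<preceq> suffix n \<alpha>" "suffix n \<alpha> \<preceq> \<alpha>" for n
      by (rule lim[of n]; use eq_suffix in \<open>fastforce simp: V2'_iff\<close>)+
    moreover have "\<not> \<mu> 0 \<and> \<alpha> 0"
      using approx[of 1] by (auto simp: V2'_iff eq_upto_def)
    ultimately show ?thesis
      by (simp add: eq V2'_iff)
  qed
  then show ?thesis
    using closure_of_subset_eq[of V2' Seq2.mtopology] by auto
qed

lemma cl_U2'_eq: "cl_U2' = V2' - linked"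
proof (intro equalityI subsetI)
  fix p
  assume p: "p \<in> cl_U2'"
  have "cl_U2' \<subseteq> V2'"
    unfolding cl_U2'_def using U2'_subset closedin_V2' by (intro closure_of_minimal) auto
  then have V: "p \<in> V2'"
    using p by blast
  have "p \<notin> linked"
  proof
    assume "p \<in> linked"
    then obtain N where N: "\<And>q. q \<in> V2' \<Longrightarrow> near N p q \<Longrightarrow> q = p"
      using linked_isolated[OF V] by blast
    obtain q where "q \<in> U2'" "near N p q"
      using p unfolding cl_U2'_def closure_iff_near by blast
    then show False
      using N[of q] U2'_subset \<open>p \<in> linked\<close> by blast
  qed
  then show "p \<in> V2' - linked"
    using V by simp
qed (use approximations(1) in \<open>auto simp: cl_U2'_def closure_iff_near\<close>)

lemma periodic_eq_iter:
  assumes "suffix P x = x" "P > 0"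
  shows "x = (prefix P x)\<^sup>\<omega>"
proof
  fix t
  have "x t = x (t mod P)"
  proof (induction t rule: less_induct)
    case (less t)
    show ?case
    proof (cases "t < P")
      case False
      then have "x t = x (t - P)"
        using fun_cong[OF assms(1), of "t - P"] by simp
      also have "\<dots> = x ((t - P) mod P)"
        using False assms(2) by (intro less.IH) simp
      finally show ?thesis
        using False by (simp add: le_mod_geq)
    qed simp
  qed
  then show "x t = (prefix P x)\<^sup>\<omega> t"
    using assms(2) by simp
qed

text \<open>
  A linked pair is determined by a period word of \<open>\<mu>\<close> and the shift that leads from \<open>\<mu>\<close> to \<open>\<alpha>\<close>.
\<close>

lemma countable_linked: "countable linked"
proof (rule countable_subset)
  let ?f = "\<lambda>(w, m). (w\<^sup>\<omega>, suffix m (w\<^sup>\<omega>)) :: bseq \<times> bseq"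
  show "linked \<subseteq> range ?f"
  proof
    fix p
    assume "p \<in> linked"
    then obtain \<mu> \<alpha> m n where p: "p = (\<mu>, \<alpha>)" "m \<ge> 1" "suffix m \<mu> = \<alpha>" "suffix n \<alpha> = \<mu>"
      by (auto simp: linked_def)
    have "suffix (m + n) \<mu> = \<mu>"
      using p by auto
    then have "\<mu> = (prefix (m + n) \<mu>)\<^sup>\<omega>"
      using p(2) by (intro periodic_eq_iter) auto
    then have "p = ?f (prefix (m + n) \<mu>, m)"
      using p by simp
    then show "p \<in> range ?f"
      by blast
  qed
qed simp

lemma uncountable_boundary: "uncountable (cl_U2' - U2')"
proof
  assume "countable (cl_U2' - U2')"
  moreover have "inj (\<lambda>c. (interleave c, \<lambda>_. True) :: bseq \<times> bseq)"
    using inj_interleave by (auto simp: inj_def)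
  moreover have "range (\<lambda>c. (interleave c, \<lambda>_. True)) \<subseteq> cl_U2' - U2'"
    using interleave_boundary by (auto simp: cl_U2'_eq)
  ultimately have "countable (UNIV :: bseq set)"
    by (meson countable_image_inj_on countable_subset)
  then obtain f :: "nat \<Rightarrow> bseq" where "range f = UNIV"
    using range_from_nat_into[of "UNIV :: bseq set"] by blast
  then obtain n where "f n = (\<lambda>t. \<not> f t t)"
    by (metis UNIV_I imageE)
  then show False
    by (metis (no_types))
qed

text \<open>
  Every finite word can be continued by \<open>1000\<dots>\<close>. Such a sequence has the shift \<open>000\<dots>\<close>, below
  which no other sequence lies, so it is not the first component of a pair in \<open>V2'\<close>.
\<close>

lemma interior_V2': "Seq2.mtopology interior_of V2' = {}"
proof (rule ccontr)
  assume "Seq2.mtopology interior_of V2' \<noteq> {}"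
  then obtain p T where p: "p \<in> T" "openin Seq2.mtopology T" "T \<subseteq> V2'"
    by (auto simp: interior_of_def)
  then obtain n where n: "\<And>q. near n p q \<Longrightarrow> q \<in> V2'"
    unfolding openin_iff_near by blast
  define x where "x t \<longleftrightarrow> (if t < n then fst p t else t = n)" for t
  have "near n p (x, snd p)"
    by (simp add: near_def eq_upto_def x_def)
  then have "(x, snd p) \<in> V2'"
    by (rule n)
  then have "x \<preceq> suffix (Suc n) x"
    by (simp add: V2'_iff)
  moreover have "suffix (Suc n) x = (\<lambda>_. False)"
    by (simp add: fun_eq_iff x_def)
  ultimately have "x = (\<lambda>_. False)"
    by (auto simp: lex_le_def lex_less_iff)
  then show False
    using x_def[of n] by simp
qed

theorem theorem2:
  shows "(U2' \<subset> cl_U2' \<and> cl_U2' \<subset> V2') \<and>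
    (\<forall>\<mu> \<alpha>. (\<mu>, \<alpha>) \<in> cl_U2' \<longleftrightarrow>
        (\<mu>, \<alpha>) \<in> V2' \<and> \<not> (\<exists>m\<ge>1. \<exists>n\<ge>1. (shift ^^ m) \<mu> = \<alpha> \<and> (shift ^^ n) \<alpha> = \<mu>)) \<and>
    (\<forall>\<mu> \<alpha>. (\<mu>, \<alpha>) \<in> V2' - cl_U2' \<longleftrightarrow>
        (\<mu>, \<alpha>) \<in> V2' \<and> (\<exists>m\<ge>1. \<exists>n\<ge>1. (shift ^^ m) \<mu> = \<alpha> \<and> (shift ^^ n) \<alpha> = \<mu>)) \<and>
    compactin Seq2.mtopology V2' \<and>
    cantor_set_in Seq2.mtopology cl_U2' \<and>
    (dense_subset_of Seq2.mtopology (cl_U2' - U2') cl_U2' \<and>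
      countable (V2' - cl_U2') \<and> dense_subset_of Seq2.mtopology (V2' - cl_U2') V2') \<and>
    uncountable (cl_U2' - U2')"
proof (intro conjI)
  show "U2' \<subset> cl_U2'"
    using U2'_subset interleave_boundary cl_U2'_eq by blast
  show "cl_U2' \<subset> V2'"
    using alternating_linked cl_U2'_eq by blast
  show "\<forall>\<mu> \<alpha>. (\<mu>, \<alpha>) \<in> cl_U2' \<longleftrightarrow>
      (\<mu>, \<alpha>) \<in> V2' \<and> \<not> (\<exists>m\<ge>1. \<exists>n\<ge>1. (shift ^^ m) \<mu> = \<alpha> \<and> (shift ^^ n) \<alpha> = \<mu>)"
    by (simp add: cl_U2'_eq linked_def)
  show "\<forall>\<mu> \<alpha>. (\<mu>, \<alpha>) \<in> V2' - cl_U2' \<longleftrightarrow>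
      (\<mu>, \<alpha>) \<in> V2' \<and> (\<exists>m\<ge>1. \<exists>n\<ge>1. (shift ^^ m) \<mu> = \<alpha> \<and> (shift ^^ n) \<alpha> = \<mu>)"
    by (auto simp: cl_U2'_eq linked_def)
  show compact: "compactin Seq2.mtopology V2'"
    using closed_compactin[OF compactin_UNIV subset_UNIV closedin_V2'] .
  show "cantor_set_in Seq2.mtopology cl_U2'"
    unfolding cantor_set_in_def
  proof (intro conjI)
    show "cl_U2' \<noteq> {}"
      using interleave_boundary cl_U2'_eq by blast
    have "closedin Seq2.mtopology cl_U2'"
      unfolding cl_U2'_def by simp
    then show "compactin Seq2.mtopology cl_U2'"
      by (rule closed_compactin[OF compactin_UNIV subset_UNIV])
    show "\<not> (\<exists>x\<in>cl_U2'. \<exists>T. openin Seq2.mtopology T \<and> T \<inter> cl_U2' = {x})"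
    proof
      assume "\<exists>x\<in>cl_U2'. \<exists>T. openin Seq2.mtopology T \<and> T \<inter> cl_U2' = {x}"
      then obtain x T where x: "x \<in> cl_U2'" and T: "openin Seq2.mtopology T" "T \<inter> cl_U2' = {x}"
        by blast
      then obtain n where n: "\<And>q. near n x q \<Longrightarrow> q \<in> T"
        unfolding openin_iff_near by blast
      obtain q q' where "q \<in> U2'" "near n x q" "q' \<in> V2' - linked - U2'" "near n x q'"
        using approximations[of x n] x cl_U2'_eq by blast
      then have "q = x" "q' = x" "q \<noteq> q'"
        using n T(2) U2'_subset cl_U2'_eq by blast+
      then show False by simp
    qed
    show "Seq2.mtopology interior_of cl_U2' = {}"
      using interior_V2' interior_of_mono[of cl_U2' V2' Seq2.mtopology] cl_U2'_eq by blast
  qed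
  show "dense_subset_of Seq2.mtopology (cl_U2' - U2') cl_U2'"
    unfolding dense_subset_of_def using approximations(2) by (auto simp: closure_iff_near cl_U2'_eq)
  have V_diff: "V2' - cl_U2' = V2' \<inter> linked"
    using cl_U2'_eq by blast
  then show "countable (V2' - cl_U2')"
    using countable_linked by (auto intro: countable_subset)
  have "p \<in> Seq2.mtopology closure_of (V2' \<inter> linked)" if "p \<in> V2'" for p
    unfolding closure_iff_near using that approximations(3)[of p] near_refl by (cases "p \<in> linked") blast+
  then show "dense_subset_of Seq2.mtopology (V2' - cl_U2') V2'"
    unfolding dense_subset_of_def V_diff by blast
  show "uncountable (cl_U2' - U2')"
    by (rule uncountable_boundary)
qed

end
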